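(* Let $n\geq 5$ be odd, $N\geq n$, and $0<\ell_1<\dots<\ell_{n-1}<\ell_n=N$; set $\ell_0=0$. Let $C_{2N}$ be the cycle with nodes $v_0,\dots,v_{2N-1}$ and edges $j=v_jv_{(j+1)\bmod 2N}$ for $0\leq j<2N$, and let $S_{2N}=\{\{v_i,v_{(i+N)\bmod 2N}\}:1\leq i\leq N\}$. For $\beta\in\{1,2\}$ let $\beta'=3-\beta$, and for $1\leq j\leq n$ let $(\beta_j,\beta'_j)=(\beta,\beta')$ if $j$ is odd and $(\beta_j,\beta'_j)=(\beta',\beta)$ if $j$ is even. Then the inequality $$\sum_{j=1}^{n}\ \sum_{i=\ell_{j-1}}^{\ell_j-1}\left(\beta_j x_i+\beta'_j x_{i+N}\right)\geq 3$$ defines a shared facet of $\mathrm{MultC}(C_{2N},S_{2N})$.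
   Context: Given a graph $G=(V,E)$ and $S\subseteq\binom{V}{2}$, an ($S$-)multicut is a set $\delta\subseteq E$ such that for every $\{s,t\}\in S$ the nodes $s$ and $t$ lie in different components of $G-\delta$. For $F\subseteq E$, $x^F\in\mathbb{R}^E$ is its incidence vector. The multicut polytope is $\mathrm{MultC}^{\square}(G,S)=\mathrm{conv}\{x^\delta:\delta\text{ an } S\text{-multicut}\}$ and the multicut dominant is $\mathrm{MultC}(G,S)=\mathrm{MultC}^{\square}(G,S)+\mathbb{R}^E_{\geq 0}$. A facet-defining inequality of $\mathrm{MultC}(G,S)$ defines a shared facet if it is also facet-defining for $\mathrm{MultC}^{\square}(G,S)$. *)

theory Defs
  imports "HOL-Analysis.Analysis"
begin

text \<open>
  The edge set of a graph is a finite type \<open>'e\<close>, so that the space of real vectors indexed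
  by the edges is the Euclidean space \<open>real ^ 'e\<close>; \<open>ends G e\<close> is the set of the two
  end nodes of the edge \<open>e\<close>.
\<close>

record ('v, 'e) ugraph =
  nodes :: "'v set"
  ends :: "'e \<Rightarrow> 'v set"

text \<open>The component of \<open>G - \<delta>\<close> that contains the node \<open>u\<close>.\<close>

definition component :: "('v, 'e) ugraph \<Rightarrow> 'e set \<Rightarrow> 'v \<Rightarrow> 'v set" where
  "component G \<delta> u = {w \<in> nodes G. (u, w) \<in> {(a, b). \<exists>e. e \<notin> \<delta> \<and> ends G e = {a, b}}\<^sup>*}"

definition multicut :: "('v, 'e) ugraph \<Rightarrow> 'v set set \<Rightarrow> 'e set \<Rightarrow> bool" where
  "multicut G S \<delta> \<longleftrightarrow> (\<forall>s t. {s, t} \<in> S \<longrightarrow> component G \<delta> s \<noteq> component G \<delta> t)"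

definition incidence :: "'e set \<Rightarrow> real ^ 'e::finite" where
  "incidence F = (\<chi> e. if e \<in> F then 1 else 0)"

definition multicut_polytope :: "('v, 'e::finite) ugraph \<Rightarrow> 'v set set \<Rightarrow> (real ^ 'e) set" where
  "multicut_polytope G S = convex hull {incidence \<delta> | \<delta>. multicut G S \<delta>}"

definition multicut_dominant :: "('v, 'e::finite) ugraph \<Rightarrow> 'v set set \<Rightarrow> (real ^ 'e) set" where
  "multicut_dominant G S = {p + y | p y. p \<in> multicut_polytope G S \<and> (\<forall>e. 0 \<le> y $ e)}"

text \<open>The inequality \<open>f x \<ge> b\<close> is facet-defining for \<open>P\<close>.\<close>

definition facet_defining :: "('a::euclidean_space \<Rightarrow> real) \<Rightarrow> real \<Rightarrow> 'a set \<Rightarrow> bool" where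
  "facet_defining f b P \<longleftrightarrow>
     linear f \<and> (\<forall>x\<in>P. f x \<ge> b) \<and> {x \<in> P. f x = b} facet_of P"

definition defines_shared_facet ::
  "(real ^ 'e::finite \<Rightarrow> real) \<Rightarrow> real \<Rightarrow> ('v, 'e) ugraph \<Rightarrow> 'v set set \<Rightarrow> bool" where
  "defines_shared_facet f b G S \<longleftrightarrow>
     facet_defining f b (multicut_dominant G S) \<and> facet_defining f b (multicut_polytope G S)"

text \<open>
  \<open>G\<close> is the cycle with the distinct nodes \<open>v 0, \<dots>, v (k - 1)\<close> and the edges
  \<open>edge 0, \<dots>, edge (k - 1)\<close>, where \<open>edge j\<close> joins \<open>v j\<close> and \<open>v ((j + 1) mod k)\<close>.
  In particular the edge type has exactly \<open>k\<close> elements.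
\<close>

definition is_cycle :: "('v, 'e) ugraph \<Rightarrow> nat \<Rightarrow> (nat \<Rightarrow> 'v) \<Rightarrow> (nat \<Rightarrow> 'e) \<Rightarrow> bool" where
  "is_cycle G k v edge \<longleftrightarrow>
     inj_on v {..<k} \<and> nodes G = v ` {..<k} \<and>
     bij_betw edge {..<k} UNIV \<and>
     (\<forall>j<k. ends G (edge j) = {v j, v ((j + 1) mod k)})"

definition antipodal_pairs :: "nat \<Rightarrow> (nat \<Rightarrow> 'v) \<Rightarrow> 'v set set" where
  "antipodal_pairs N v = {{v i, v ((i + N) mod (2 * N))} | i. 1 \<le> i \<and> i \<le> N}"

end

theory Submission
  imports Defs
begin

text \<open>
  A set of edges of the cycle is an antipodal multicut iff it meets every path of \<open>N\<close> consecutive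
  edges. Antipodal edges have weights summing to 3, all weights are at least 1, and a two-element
  multicut is an antipodal pair, so the inequality is valid. The tight multicuts are the antipodal
  pairs and the well-spread triples of edges of weight 1. Choose from each antipodal pair the edge
  of weight 1: indexing these edges by the positions \<open>0, \<dots>, N - 1\<close>, a triple is a multicut iff
  the weights at its positions alternate. Each position lies in an alternating chain of five
  positions, and a linear form that vanishes on all tight multicuts vanishes on the edges of such
  a chain. Hence the tight multicuts span the whole space.
\<close>

section \<open>Facets from spanning sets of tight points\<close>

text \<open>The spanning hypothesis is in dual form, so it is checked by showing that a linear form
  vanishing on the tight points is zero. A face that spans the space linearly has affine dimension
  at least one less than the whole space, and \<open>z\<close> makes the face proper, which leaves
  no other dimension.\<close>

lemma facet_definingI:
  fixes w :: "'a::euclidean_space"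
  assumes "convex P" and valid: "\<And>x. x \<in> P \<Longrightarrow> w \<bullet> x \<ge> b"
    and "z \<in> P" and "w \<bullet> z \<noteq> b"
    and TP: "T \<subseteq> P" and Tb: "\<And>x. x \<in> T \<Longrightarrow> w \<bullet> x = b"
    and spanning: "\<And>a. (\<And>x. x \<in> T \<Longrightarrow> a \<bullet> x = 0) \<Longrightarrow> a = 0"
  shows "facet_defining (\<lambda>x. w \<bullet> x) b P"
proof -
  define F where "F = {x \<in> P. w \<bullet> x = b}"
  have F_eq: "F = P \<inter> {x. w \<bullet> x = b}" by (auto simp: F_def)
  have face: "F face_of P"
    unfolding F_eq by (rule face_of_Int_supporting_hyperplane_ge) (use assms in auto)
  have "span F = UNIV"
  proof (rule ccontr)
    assume "span F \<noteq> UNIV"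
    then obtain a where "a \<noteq> 0" and a: "\<And>x. x \<in> span F \<Longrightarrow> a \<bullet> x = 0"
      using span_not_UNIV_orthogonal by blast
    have "x \<in> F" if "x \<in> T" for x
      using that TP Tb by (auto simp: F_def)
    then have "a = 0"
      by (intro spanning a span_base)
    with \<open>a \<noteq> 0\<close> show False by simp
  qed
  then have "dim F = DIM('a)"
    by (metis dim_UNIV dim_span)
  \<comment> \<open>Once the origin is added, affine and linear dimension agree; dropping it again
    costs at most one.\<close>
  then have "aff_dim (insert 0 F) = DIM('a)"
    by (subst aff_dim_zero) (auto intro: hull_inc simp: dim_insert span_zero)
  then have ge: "aff_dim F \<ge> int DIM('a) - 1"
    by (auto simp: aff_dim_insert split: if_splits)
  have "F \<noteq> P" using assms by (auto simp: F_def)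
  with face \<open>convex P\<close> have "aff_dim F < aff_dim P"
    by (intro face_of_aff_dim_lt)
  moreover have "aff_dim P \<le> DIM('a)" by (rule aff_dim_le_DIM)
  ultimately have "aff_dim F = aff_dim P - 1" using ge by linarith
  moreover have "F \<noteq> {}"
  proof
    assume "F = {}"
    then have "aff_dim F = - 1" by simp
    with ge show False using DIM_positive[where 'a='a] by linarith
  qed
  ultimately show ?thesis
    using face valid by (auto simp: facet_defining_def facet_of_def F_def intro!: linearI inner_right_distrib)
qed

section \<open>Incidence vectors, the polytope and the dominant\<close>

lemma inner_incidence: "w \<bullet> incidence F = (\<Sum>e\<in>F. w $ e)"
  by (simp add: inner_vec_def incidence_def if_distrib[of "\<lambda>t. _ * t"] sum.If_cases cong: if_cong)

lemma convex_multicut_polytope: "convex (multicut_polytope G S)"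
  by (simp add: multicut_polytope_def)

lemma convex_multicut_dominant:
  fixes G :: "('v, 'e::finite) ugraph"
  shows "convex (multicut_dominant G S)"
proof -
  have "multicut_dominant G S = (\<Union>p\<in>multicut_polytope G S. \<Union>y\<in>{y. \<forall>e. 0 \<le> y $ e}. {p + y})"
    by (auto simp: multicut_dominant_def)
  moreover have "convex {y :: real ^ 'e. \<forall>e. 0 \<le> y $ e}"
    by (auto simp: convex_def)
  ultimately show ?thesis
    by (simp only: convex_sums[OF convex_multicut_polytope])
qed

lemma incidence_in_multicut_polytope:
  "multicut G S \<delta> \<Longrightarrow> incidence \<delta> \<in> multicut_polytope G S"
  by (auto simp: multicut_polytope_def intro: hull_inc)

lemma multicut_polytope_subset_dominant:
  fixes G :: "('v, 'e::finite) ugraph"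
  shows "multicut_polytope G S \<subseteq> multicut_dominant G S"
proof
  fix p assume "p \<in> multicut_polytope G S"
  moreover have "p = p + 0" "\<forall>e. 0 \<le> (0 :: real ^ 'e) $ e" by auto
  ultimately show "p \<in> multicut_dominant G S"
    unfolding multicut_dominant_def by blast
qed

text \<open>The polytope lies in the dominant, so the same tight incidence vectors and the same
  non-tight point serve for both. Validity passes from the polytope to the dominant because
  \<open>w\<close> is nonnegative.\<close>

lemma defines_shared_facetI:
  fixes w :: "real ^ 'e::finite"
  assumes nonneg: "\<And>e. w $ e \<ge> 0"
    and valid: "\<And>\<delta>. multicut G S \<delta> \<Longrightarrow> (\<Sum>e\<in>\<delta>. w $ e) \<ge> b"
    and strict: "multicut G S \<delta>\<^sub>0" "(\<Sum>e\<in>\<delta>\<^sub>0. w $ e) \<noteq> b"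
    and spanning: "\<And>a :: real ^ 'e.
      (\<And>\<delta>. multicut G S \<delta> \<Longrightarrow> (\<Sum>e\<in>\<delta>. w $ e) = b \<Longrightarrow> (\<Sum>e\<in>\<delta>. a $ e) = 0) \<Longrightarrow> a = 0"
  shows "defines_shared_facet (\<lambda>x. w \<bullet> x) b G S"
proof -
  define T where "T = incidence ` {\<delta>. multicut G S \<delta> \<and> (\<Sum>e\<in>\<delta>. w $ e) = b}"
  have T_polytope: "T \<subseteq> multicut_polytope G S"
    by (auto simp: T_def intro: incidence_in_multicut_polytope)
  have T_tight: "w \<bullet> x = b" if "x \<in> T" for x
    using that by (auto simp: T_def inner_incidence)
  have T_spanning: "a = 0" if "\<And>x. x \<in> T \<Longrightarrow> a \<bullet> x = 0" for a
  proof (rule spanning)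
    fix \<delta> assume "multicut G S \<delta>" "(\<Sum>e\<in>\<delta>. w $ e) = b"
    then have "incidence \<delta> \<in> T" by (simp add: T_def)
    from that[OF this] show "(\<Sum>e\<in>\<delta>. a $ e) = 0" by (simp add: inner_incidence)
  qed
  have polytope: "w \<bullet> x \<ge> b" if "x \<in> multicut_polytope G S" for x
  proof -
    have "multicut_polytope G S \<subseteq> {x. w \<bullet> x \<ge> b}"
      unfolding multicut_polytope_def
      by (rule hull_minimal) (auto simp: inner_incidence valid convex_halfspace_ge)
    with that show ?thesis by auto
  qed
  have dominant: "w \<bullet> x \<ge> b" if x_in: "x \<in> multicut_dominant G S" for x
  proof -
    obtain p y where x: "x = p + y" and p: "p \<in> multicut_polytope G S" and "\<forall>e. 0 \<le> y $ e"
      using x_in unfolding multicut_dominant_def by blast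
    then have "w \<bullet> y \<ge> 0"
      by (auto simp: inner_vec_def nonneg intro!: sum_nonneg)
    with polytope[OF p] show ?thesis by (simp add: x inner_right_distrib)
  qed
  have z: "incidence \<delta>\<^sub>0 \<in> multicut_polytope G S" "w \<bullet> incidence \<delta>\<^sub>0 \<noteq> b"
    using strict by (auto simp: inner_incidence incidence_in_multicut_polytope)
  show ?thesis
    unfolding defines_shared_facet_def
  proof
    show "facet_defining (\<lambda>x. w \<bullet> x) b (multicut_polytope G S)"
      using convex_multicut_polytope polytope z T_polytope T_tight T_spanning
      by (rule facet_definingI)
    show "facet_defining (\<lambda>x. w \<bullet> x) b (multicut_dominant G S)"
      using convex_multicut_dominant dominant
        subsetD[OF multicut_polytope_subset_dominant z(1)] z(2)
        order_trans[OF T_polytope multicut_polytope_subset_dominant] T_tight T_spanning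
      by (rule facet_definingI)
  qed
qed

section \<open>Multicuts of an even cycle\<close>

abbreviation adj :: "('v, 'e) ugraph \<Rightarrow> 'e set \<Rightarrow> ('v \<times> 'v) set" where
  "adj G \<delta> \<equiv> {(a, b). \<exists>e. e \<notin> \<delta> \<and> ends G e = {a, b}}"

lemma adj_rtrancl_sym:
  assumes "(a, b) \<in> (adj G \<delta>)\<^sup>*" shows "(b, a) \<in> (adj G \<delta>)\<^sup>*"
proof -
  have "sym (adj G \<delta>)" by (auto simp: sym_def insert_commute)
  with assms show ?thesis by (blast dest: sym_rtrancl symD)
qed

lemma component_eq_iff:
  assumes "s \<in> nodes G" "t \<in> nodes G"
  shows "component G \<delta> s = component G \<delta> t \<longleftrightarrow> (s, t) \<in> (adj G \<delta>)\<^sup>*"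
proof
  assume "component G \<delta> s = component G \<delta> t"
  moreover have "t \<in> component G \<delta> t" using assms by (simp add: component_def)
  ultimately show "(s, t) \<in> (adj G \<delta>)\<^sup>*" by (auto simp: component_def)
next
  assume st: "(s, t) \<in> (adj G \<delta>)\<^sup>*"
  then have ts: "(t, s) \<in> (adj G \<delta>)\<^sup>*" by (rule adj_rtrancl_sym)
  show "component G \<delta> s = component G \<delta> t"
    unfolding component_def using rtrancl_trans[OF st] rtrancl_trans[OF ts] by blast
qed

text \<open>Certificate of separation: a set \<open>A\<close> that no remaining edge crosses
  separates its elements from all other nodes.\<close>

lemma adj_rtrancl_invariant:
  assumes "(a, b) \<in> (adj G \<delta>)\<^sup>*"
    and "\<And>e x y. e \<notin> \<delta> \<Longrightarrow> ends G e = {x, y} \<Longrightarrow> x \<in> A \<longleftrightarrow> y \<in> A"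
  shows "a \<in> A \<longleftrightarrow> b \<in> A"
  using assms(1) by induction (auto simp: assms(2))

locale even_cycle =
  fixes G :: "('v, 'e) ugraph" and N :: nat and v :: "nat \<Rightarrow> 'v" and edge :: "nat \<Rightarrow> 'e"
  assumes cycle: "is_cycle G (2 * N) v edge" and N_pos: "N > 0"
begin

lemma v_eq_iff: "i < 2 * N \<Longrightarrow> j < 2 * N \<Longrightarrow> v i = v j \<longleftrightarrow> i = j"
  using cycle by (auto simp: is_cycle_def inj_on_def)

lemma v_in_nodes: "i < 2 * N \<Longrightarrow> v i \<in> nodes G"
  using cycle by (auto simp: is_cycle_def)

lemma bij_edge: "bij_betw edge {..<2 * N} UNIV"
  using cycle by (simp add: is_cycle_def)

lemma edge_eq_iff: "i < 2 * N \<Longrightarrow> j < 2 * N \<Longrightarrow> edge i = edge j \<longleftrightarrow> i = j"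
  using bij_edge by (auto simp: bij_betw_def inj_on_def)

lemma ends_edge: "i < 2 * N \<Longrightarrow> ends G (edge i) = {v i, v (Suc i mod (2 * N))}"
  using cycle by (simp add: is_cycle_def)

lemma edge_cases: obtains i where "i < 2 * N" "e = edge i"
  using bij_edge by (metis UNIV_I bij_betw_iff_bijections lessThan_iff)

lemma edge_set_cases:
  obtains K where "K \<subseteq> {..<2 * N}" "\<delta> = edge ` K"
  using bij_edge by (metis bij_betw_imp_surj_on subset_UNIV subset_imageE)

lemma edge_in_image_iff:
  "K \<subseteq> {..<2 * N} \<Longrightarrow> i < 2 * N \<Longrightarrow> edge i \<in> edge ` K \<longleftrightarrow> i \<in> K"
  using edge_eq_iff by blast

lemma inj_on_edge: "K \<subseteq> {..<2 * N} \<Longrightarrow> inj_on edge K"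
  using bij_edge by (meson bij_betw_def inj_on_subset)

text \<open>Only \<open>i = N\<close> wraps around, and it gives the pair of index 0. Shifting the
  range therefore removes the \<open>mod\<close>.\<close>

lemma antipodal_pairs_eq: "antipodal_pairs N v = {{v i, v (i + N)} | i. i < N}"
proof (intro subset_antisym subsetI)
  fix P assume "P \<in> antipodal_pairs N v"
  then obtain i where i: "P = {v i, v ((i + N) mod (2 * N))}" "1 \<le> i" "i \<le> N"
    by (auto simp: antipodal_pairs_def)
  show "P \<in> {{v i, v (i + N)} | i. i < N}"
  proof (cases "i = N")
    case True
    then have "P = {v 0, v (0 + N)}"
      using i by (simp add: mult_2 insert_commute)
    then show ?thesis using N_pos by blast
  qed (use i in auto)
next
  fix P assume "P \<in> {{v i, v (i + N)} | i. i < N}"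
  then obtain i where i: "P = {v i, v (i + N)}" "i < N" by auto
  show "P \<in> antipodal_pairs N v"
  proof (cases "i = 0")
    case True
    then have "P = {v N, v ((N + N) mod (2 * N))}"
      using i by (simp add: mult_2 insert_commute)
    then show ?thesis unfolding antipodal_pairs_def using N_pos by force
  next
    case False
    then have "P = {v i, v ((i + N) mod (2 * N))}" "1 \<le> i" "i \<le> N" using i by auto
    then show ?thesis unfolding antipodal_pairs_def by blast
  qed
qed

lemma multicut_iff:
  "multicut G (antipodal_pairs N v) \<delta> \<longleftrightarrow> (\<forall>i<N. (v i, v (i + N)) \<notin> (adj G \<delta>)\<^sup>*)"
proof -
  have "multicut G (antipodal_pairs N v) \<delta> \<longleftrightarrow>
      (\<forall>i<N. component G \<delta> (v i) \<noteq> component G \<delta> (v (i + N)))"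
    unfolding multicut_def antipodal_pairs_eq by (fastforce simp: doubleton_eq_iff)
  also have "\<dots> \<longleftrightarrow> (\<forall>i<N. (v i, v (i + N)) \<notin> (adj G \<delta>)\<^sup>*)"
    by (simp add: component_eq_iff v_in_nodes)
  finally show ?thesis .
qed

section \<open>Paths that a multicut has to hit\<close>

lemma path_rtrancl:
  assumes "i \<le> j" "j < 2 * N" "\<And>k. i \<le> k \<Longrightarrow> k < j \<Longrightarrow> edge k \<notin> \<delta>"
  shows "(v i, v j) \<in> (adj G \<delta>)\<^sup>*"
  using assms
proof (induction j rule: dec_induct)
  case (step j)
  then have "(v i, v j) \<in> (adj G \<delta>)\<^sup>*" by simp
  moreover have "(v j, v (Suc j)) \<in> adj G \<delta>"
    using step.prems step.hyps ends_edge[of j] by auto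
  ultimately show ?case by (rule rtrancl_into_rtrancl)
qed simp

lemma multicut_hits_inside:
  assumes "multicut G (antipodal_pairs N v) (edge ` K)" and K: "K \<subseteq> {..<2 * N}" and "i < N"
  shows "\<exists>k\<in>K. i \<le> k \<and> k < i + N"
proof (rule ccontr)
  assume "\<not> ?thesis"
  then have "edge k \<notin> edge ` K" if "i \<le> k" "k < i + N" for k
    using that assms by (subst edge_in_image_iff[OF K]) auto
  then have "(v i, v (i + N)) \<in> (adj G (edge ` K))\<^sup>*"
    using assms by (intro path_rtrancl) auto
  with assms show False by (auto simp: multicut_iff)
qed

lemma multicut_hits_outside:
  assumes "multicut G (antipodal_pairs N v) (edge ` K)" and K: "K \<subseteq> {..<2 * N}" and "i < N"
  shows "\<exists>k\<in>K. k < i \<or> i + N \<le> k"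
proof (rule ccontr)
  assume "\<not> ?thesis"
  then have free: "edge k \<notin> edge ` K" if "k < i \<or> i + N \<le> k" "k < 2 * N" for k
    using that by (subst edge_in_image_iff[OF K]) auto
  let ?R = "(adj G (edge ` K))\<^sup>*"
  have "(v 0, v i) \<in> ?R"
    using assms by (intro path_rtrancl free) auto
  \<comment> \<open>The complementary path from \<open>v (i + N)\<close> to \<open>v i\<close> uses
    the closing edge, which \<open>path_rtrancl\<close> does not cover because it never wraps
    around.\<close>
  moreover have "edge (2 * N - 1) \<notin> edge ` K"
    using assms by (intro free) auto
  then have "(v (2 * N - 1), v 0) \<in> ?R"
    using ends_edge[of "2 * N - 1"] N_pos by (intro r_into_rtrancl) auto
  moreover have "(v (i + N), v (2 * N - 1)) \<in> ?R"
    using assms by (intro path_rtrancl free) auto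
  ultimately have "(v (i + N), v i) \<in> ?R" by (meson rtrancl_trans)
  with assms show False by (auto simp: multicut_iff dest: adj_rtrancl_sym)
qed

text \<open>Removing the edges \<open>p\<close> and \<open>q\<close> cuts off the arc of nodes from
  \<open>p + 1\<close> to \<open>q\<close>. The hypothesis provides, for each antipodal pair, such
  an arc that contains exactly one of the two nodes.\<close>

lemma multicutI:
  assumes "K \<subseteq> {..<2 * N}"
    and sep: "\<And>i. i < N \<Longrightarrow>
      \<exists>p\<in>K. \<exists>q\<in>K. (p < i \<and> i \<le> q) \<noteq> (p < i + N \<and> i + N \<le> q)"
  shows "multicut G (antipodal_pairs N v) (edge ` K)"
  unfolding multicut_iff
proof (intro allI impI notI)
  fix i assume i: "i < N" and path: "(v i, v (i + N)) \<in> (adj G (edge ` K))\<^sup>*"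
  obtain p q where pq: "p \<in> K" "q \<in> K" "(p < i \<and> i \<le> q) \<noteq> (p < i + N \<and> i + N \<le> q)"
    using sep[OF i] by blast
  then have bounds: "p < 2 * N" "q < 2 * N" using assms by auto
  define A where "A = v ` {p<..q}"
  have A_iff: "v j \<in> A \<longleftrightarrow> p < j \<and> j \<le> q" if "j < 2 * N" for j
    using that bounds by (auto simp: A_def v_eq_iff image_iff)
  have step: "v j \<in> A \<longleftrightarrow> v (Suc j mod (2 * N)) \<in> A" if "j < 2 * N" "j \<noteq> p" "j \<noteq> q" for j
  proof (cases "Suc j = 2 * N")
    case True
    \<comment> \<open>The arc never contains node 0, and it contains the last node only if
      \<open>q\<close> is the closing edge, which \<open>j \<noteq> q\<close> excludes.\<close>
    then have "v j \<notin> A" "v 0 \<notin> A" using that bounds N_pos by (auto simp: A_iff)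
    then show ?thesis using True by simp
  qed (use that in \<open>auto simp: A_iff\<close>)
  have inv: "x \<in> A \<longleftrightarrow> y \<in> A" if "e \<notin> edge ` K" "ends G e = {x, y}" for e x y
  proof -
    obtain j where j: "j < 2 * N" "e = edge j" by (rule edge_cases)
    with that pq have "j \<noteq> p" "j \<noteq> q" by auto
    from step[OF j(1) this] that(2) j show ?thesis
      by (auto simp: ends_edge doubleton_eq_iff)
  qed
  have "v i \<in> A \<longleftrightarrow> v (i + N) \<in> A"
    using path inv by (rule adj_rtrancl_invariant)
  then have "(p < i \<and> i \<le> q) = (p < i + N \<and> i + N \<le> q)"
    using A_iff[of i] A_iff[of "i + N"] i by simp
  with pq(3) show False by blast
qed

section \<open>Explicit multicuts, and the shape of small ones\<close>

lemma multicut_UNIV: "multicut G (antipodal_pairs N v) UNIV"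
proof -
  have "multicut G (antipodal_pairs N v) (edge ` {..<2 * N})"
  proof (rule multicutI)
    fix i assume "i < N"
    then show "\<exists>p\<in>{..<2 * N}. \<exists>q\<in>{..<2 * N}. (p < i \<and> i \<le> q) \<noteq> (p < i + N \<and> i + N \<le> q)"
      by (intro bexI[of _ i] bexI[of _ "i + N"]) auto
  qed simp
  then show ?thesis using bij_edge by (simp add: bij_betw_def)
qed

lemma multicut_antipodal:
  assumes "k < N" shows "multicut G (antipodal_pairs N v) (edge ` {k, k + N})"
  by (rule multicutI) (use assms in auto)

text \<open>The three remaining arcs have \<open>k - i\<close>, \<open>N - (k - j)\<close> and
  \<open>N - (j - i)\<close> nodes, all fewer than \<open>N\<close>, whereas an arc with two
  antipodal nodes has more than \<open>N\<close>. The next lemma is the same configuration rotated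
  by \<open>N\<close>.\<close>

lemma multicut_low_high_low:
  assumes "i < j" "j < k" "k < N"
  shows "multicut G (antipodal_pairs N v) (edge ` {i, j + N, k})"
proof (rule multicutI)
  fix m assume "m < N"
  then show "\<exists>p\<in>{i, j + N, k}. \<exists>q\<in>{i, j + N, k}.
      (p < m \<and> m \<le> q) \<noteq> (p < m + N \<and> m + N \<le> q)"
    using assms by simp linarith
qed (use assms in auto)

lemma multicut_high_low_high:
  assumes "i < j" "j < k" "k < N"
  shows "multicut G (antipodal_pairs N v) (edge ` {i + N, j, k + N})"
proof (rule multicutI)
  fix m assume "m < N"
  then show "\<exists>p\<in>{i + N, j, k + N}. \<exists>q\<in>{i + N, j, k + N}.
      (p < m \<and> m \<le> q) \<noteq> (p < m + N \<and> m + N \<le> q)"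
    using assms by simp linarith
qed (use assms in auto)

text \<open>This gives validity: an antipodal pair weighs 3, and three edges of weight at least 1
  weigh at least 3.\<close>

lemma multicut_two_or_more:
  assumes mc: "multicut G (antipodal_pairs N v) (edge ` K)" and K: "K \<subseteq> {..<2 * N}"
  shows "(\<exists>k<N. K = {k, k + N}) \<or> card K \<ge> 3"
proof -
  obtain p where p: "p \<in> K" "p < N"
    using multicut_hits_inside[OF mc K N_pos] by auto
  obtain q where q: "q \<in> K" "N \<le> q"
    using multicut_hits_outside[OF mc K N_pos] by auto
  have "finite K" using K finite_subset by blast
  show ?thesis
  proof (cases "K = {p, q}")
    case True
    have "q < 2 * N" using q K by auto
    \<comment> \<open>The path around the outside starting at \<open>p + N\<close> must be hit, and
      only \<open>q\<close> can hit it. In the same way, \<open>q > p + N\<close> would leave the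
      path of the edges \<open>p + 1\<close> to \<open>p + N\<close> free.\<close>
    have "q \<ge> p + N"
      using multicut_hits_outside[OF mc K p(2)] True q p by auto
    moreover have "\<not> q > p + N"
    proof
      assume "q > p + N"
      with \<open>q < 2 * N\<close> have "Suc p < N" by linarith
      from multicut_hits_inside[OF mc K this] True \<open>q > p + N\<close> show False by auto
    qed
    ultimately show ?thesis using True p by auto
  next
    case False
    then obtain r where "r \<in> K" "r \<noteq> p" "r \<noteq> q" using p q by auto
    then have "card {p, q, r} = 3" "{p, q, r} \<subseteq> K" using p q by auto
    then show ?thesis using card_mono[OF \<open>finite K\<close>] by metis
  qed
qed

end

section \<open>Antisymmetric weights with alternating chains\<close>

text \<open>When \<open>u\<close> takes only the values 1 and 2, exactly one edge of each antipodal
  pair has weight 1.\<close>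

definition antipodal_weight :: "nat \<Rightarrow> (nat \<Rightarrow> real) \<Rightarrow> nat \<Rightarrow> real" where
  "antipodal_weight N u k = (if k < N then u k else 3 - u (k - N))"

context even_cycle
begin

text \<open>\<open>s\<close> selects the edge of weight 1 from each antipodal pair. Alternation of
  \<open>u\<close> places these edges as low-high-low or high-low-high.\<close>

lemma alternating_triple_tight:
  assumes ijk: "i < j" "j < k" "k < N"
    and u: "\<And>i. i < N \<Longrightarrow> u i \<in> {1, 2}" and "u i \<noteq> u j" "u j \<noteq> u k"
  defines "s \<equiv> \<lambda>i. if u i = 1 then i else i + N"
  shows "multicut G (antipodal_pairs N v) (edge ` {s i, s j, s k})"
    and "(\<Sum>m\<in>{s i, s j, s k}. antipodal_weight N u m) = 3"
    and "{s i, s j, s k} \<subseteq> {..<2 * N}"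
proof -
  have u': "u i = 1 \<or> u i = 2" "u j = 1 \<or> u j = 2" "u k = 1 \<or> u k = 2"
    using u[of i] u[of j] u[of k] ijk by auto
  consider "u i = 1" "u j = 2" "u k = 1" | "u i = 2" "u j = 1" "u k = 2"
    using u' \<open>u i \<noteq> u j\<close> \<open>u j \<noteq> u k\<close> by metis
  note cases = this
  show "multicut G (antipodal_pairs N v) (edge ` {s i, s j, s k})"
    by (cases rule: cases)
      (use ijk multicut_low_high_low[OF ijk] multicut_high_low_high[OF ijk] in
        \<open>simp_all add: s_def\<close>)
  show "(\<Sum>m\<in>{s i, s j, s k}. antipodal_weight N u m) = 3"
    by (cases rule: cases) (use ijk in \<open>simp_all add: s_def antipodal_weight_def\<close>)
  show "{s i, s j, s k} \<subseteq> {..<2 * N}"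
    using ijk by (auto simp: s_def)
qed

end

text \<open>Chains of five are used because they have five alternating triples, as many as
  positions; a chain of four has only two.\<close>

lemma defines_shared_facet_antipodal_weight:
  fixes G :: "('v, 'e::finite) ugraph"
  assumes cycle: "is_cycle G (2 * N) v edge" and "N \<ge> 2"
    and u: "\<And>i. i < N \<Longrightarrow> u i \<in> {1, 2}"
    and chain: "\<And>i. i < N \<Longrightarrow> \<exists>p1 p2 p3 p4 p5.
      p1 < p2 \<and> p2 < p3 \<and> p3 < p4 \<and> p4 < p5 \<and> p5 < N \<and> i \<in> {p1, p2, p3, p4, p5} \<and>
      u p1 \<noteq> u p2 \<and> u p2 \<noteq> u p3 \<and> u p3 \<noteq> u p4 \<and> u p4 \<noteq> u p5"
  shows "defines_shared_facet
    (\<lambda>x. \<Sum>k<2 * N. antipodal_weight N u k * x $ edge k) 3 G (antipodal_pairs N v)"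
proof -
  interpret even_cycle G N v edge by unfold_locales (use assms in auto)
  let ?w = "antipodal_weight N u"
  define w :: "real ^ 'e" where "w = (\<chi> e. ?w (inv_into {..<2 * N} edge e))"
  have w_edge: "w $ edge k = ?w k" if "k < 2 * N" for k
    using that inj_on_edge[OF order_refl] by (simp add: w_def inv_into_f_f)
  have w_ge_1: "?w k \<ge> 1" if "k < 2 * N" for k
  proof (cases "k < N")
    case True
    then show ?thesis using u[OF True] by (auto simp: antipodal_weight_def)
  next
    case False
    with that have "k - N < N" by linarith
    from u[OF this] False show ?thesis by (auto simp: antipodal_weight_def)
  qed
  have sum_edge: "(\<Sum>e\<in>edge ` K. a $ e) = (\<Sum>k\<in>K. a $ edge k)"
    if "K \<subseteq> {..<2 * N}" for K and a :: "real ^ 'e"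
    using inj_on_edge[OF that] by (simp add: sum.reindex)
  have sum_w: "(\<Sum>e\<in>edge ` K. w $ e) = (\<Sum>k\<in>K. ?w k)" if "K \<subseteq> {..<2 * N}" for K
    unfolding sum_edge[OF that] by (rule sum.cong) (use that w_edge in auto)
  have pair_weight: "(\<Sum>k\<in>{k, k + N}. ?w k) = 3" if "k < N" for k
    using that by (simp add: antipodal_weight_def)
  have sum_ge_card: "(\<Sum>k\<in>K. ?w k) \<ge> card K" if "K \<subseteq> {..<2 * N}" for K
  proof -
    have "(\<Sum>k\<in>K. ?w k) \<ge> (\<Sum>k\<in>K. 1)"
      by (rule sum_mono) (use that in \<open>auto intro: w_ge_1\<close>)
    then show ?thesis by simp
  qed
  have "defines_shared_facet (\<lambda>x. w \<bullet> x) 3 G (antipodal_pairs N v)"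
  proof (rule defines_shared_facetI)
    fix e
    obtain k where "k < 2 * N" "e = edge k" by (rule edge_cases)
    then show "w $ e \<ge> 0" using w_edge w_ge_1[of k] by simp
  next
    fix \<delta> assume mc: "multicut G (antipodal_pairs N v) \<delta>"
    obtain K where K: "K \<subseteq> {..<2 * N}" "\<delta> = edge ` K" by (rule edge_set_cases)
    from multicut_two_or_more[OF mc[unfolded K(2)] K(1)] have "(\<Sum>k\<in>K. ?w k) \<ge> 3"
      using pair_weight sum_ge_card[OF K(1)] by fastforce
    then show "(\<Sum>e\<in>\<delta>. w $ e) \<ge> 3" by (simp add: K sum_w)
  next
    \<comment> \<open>The set of all edges is the non-tight multicut: it has at least four edges,
      each of weight at least 1.\<close>
    have "(\<Sum>k<2 * N. ?w k) \<ge> 4"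
      using sum_ge_card[of "{..<2 * N}"] \<open>N \<ge> 2\<close> by simp
    then show "(\<Sum>e\<in>UNIV. w $ e) \<noteq> 3"
      using sum_w[of "{..<2 * N}"] bij_edge by (simp add: bij_betw_def)
  next
    show "multicut G (antipodal_pairs N v) UNIV" by (rule multicut_UNIV)
  next
    fix a :: "real ^ 'e"
    assume a: "\<And>\<delta>. multicut G (antipodal_pairs N v) \<delta> \<Longrightarrow> (\<Sum>e\<in>\<delta>. w $ e) = 3 \<Longrightarrow>
      (\<Sum>e\<in>\<delta>. a $ e) = 0"
    have a_K: "(\<Sum>k\<in>K. a $ edge k) = 0"
      if "multicut G (antipodal_pairs N v) (edge ` K)" "(\<Sum>k\<in>K. ?w k) = 3" "K \<subseteq> {..<2 * N}" for K
      using a[OF that(1)] that(2) unfolding sum_w[OF that(3)] unfolding sum_edge[OF that(3)]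
      by blast
    have pair: "a $ edge k + a $ edge (k + N) = 0" if "k < N" for k
      using a_K[OF multicut_antipodal[OF that] pair_weight[OF that]] that by simp
    define s where "s i = (if u i = 1 then i else i + N)" for i
    have triple: "a $ edge (s i) + a $ edge (s j) + a $ edge (s k) = 0"
      if "i < j" "j < k" "k < N" "u i \<noteq> u j" "u j \<noteq> u k" for i j k
    proof -
      note tight = alternating_triple_tight[OF that(1-3) u that(4-5), folded s_def]
      have "s i \<noteq> s j" "s i \<noteq> s k" "s j \<noteq> s k"
        using that(1-3) by (auto simp: s_def)
      with a_K[OF tight] show ?thesis by (simp add: add.assoc)
    qed
    have zero: "a $ edge (s i) = 0" if i_less: "i < N" for i
    proof -
      obtain p1 p2 p3 p4 p5
        where lt: "p1 < p2" "p2 < p3" "p3 < p4" "p4 < p5" "p5 < N"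
          and i: "i \<in> {p1, p2, p3, p4, p5}"
          and alt: "u p1 \<noteq> u p2" "u p2 \<noteq> u p3" "u p3 \<noteq> u p4" "u p4 \<noteq> u p5"
        using chain[OF i_less] by auto
      \<comment> \<open>With only two values, positions at odd distance in the chain differ. This
        admits the triples 1, 2, 5 and 1, 4, 5.\<close>
      have "u p2 \<noteq> u p5" "u p1 \<noteq> u p4"
        using alt lt u[of p1] u[of p2] u[of p3] u[of p4] u[of p5] by auto
      then have "a $ edge (s p1) + a $ edge (s p2) + a $ edge (s p3) = 0"
        "a $ edge (s p1) + a $ edge (s p2) + a $ edge (s p5) = 0"
        "a $ edge (s p1) + a $ edge (s p4) + a $ edge (s p5) = 0"
        "a $ edge (s p3) + a $ edge (s p4) + a $ edge (s p5) = 0"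
        "a $ edge (s p2) + a $ edge (s p3) + a $ edge (s p4) = 0"
        using lt alt by (auto intro!: triple)
      \<comment> \<open>Differences of the equations give one common value c at the odd places and
        one common value d at the even places; then 2c + d = 0 and c + 2d = 0.\<close>
      then have "a $ edge (s p1) = 0 \<and> a $ edge (s p2) = 0 \<and> a $ edge (s p3) = 0 \<and>
          a $ edge (s p4) = 0 \<and> a $ edge (s p5) = 0"
        by linarith
      with i show ?thesis by auto
    qed
    \<comment> \<open>The pair equation carries the zero from the edge of weight 1 to its
      antipode.\<close>
    have both: "a $ edge k = 0 \<and> a $ edge (k + N) = 0" if "k < N" for k
      using zero[OF that] pair[OF that] by (auto simp: s_def split: if_splits)
    show "a = 0"
      unfolding vec_eq_iff
    proof
      fix e
      obtain k where k: "k < 2 * N" "e = edge k" by (rule edge_cases)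
      show "a $ e = 0 $ e"
        using both[of k] both[of "k - N"] k by (cases "k < N") auto
    qed
  qed
  moreover have "w \<bullet> x = (\<Sum>k<2 * N. ?w k * x $ edge k)" for x
  proof -
    have "w \<bullet> x = (\<Sum>e\<in>UNIV. w $ e * x $ e)" by (simp add: inner_vec_def)
    also have "\<dots> = (\<Sum>k<2 * N. w $ edge k * x $ edge k)"
      by (rule sum.reindex_bij_betw[OF bij_edge, symmetric])
    finally show ?thesis by (simp add: w_edge)
  qed
  ultimately show ?thesis by simp
qed

section \<open>Block indices\<close>

text \<open>Blocks are numbered from 1. Since \<open>l\<close> is controlled only up to
  \<open>n\<close>, the least index is taken: for \<open>i < l n\<close> it is at most
  \<open>n\<close>.\<close>

definition block :: "(nat \<Rightarrow> nat) \<Rightarrow> nat \<Rightarrow> nat" where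
  "block l i = (LEAST j. i < l j)"

lemma strictly_increasing_upto:
  fixes l :: "nat \<Rightarrow> nat"
  assumes "\<forall>j<n. l j < l (j + 1)" "j < k" "k \<le> n"
  shows "l j < l k"
  using assms(2,3)
proof (induction k)
  case (Suc k)
  then have "l k < l (Suc k)" using assms(1) by simp
  with Suc show ?case by (cases "j = k") auto
qed simp

lemma increasing_upto:
  fixes l :: "nat \<Rightarrow> nat"
  assumes "\<forall>j<n. l j < l (j + 1)" "j \<le> k" "k \<le> n"
  shows "l j \<le> l k"
  using strictly_increasing_upto[OF assms(1), of j k] assms(2,3) by (cases "j = k") auto

lemma block_eq:
  assumes inc: "\<forall>j<n. l j < l (j + 1)" and "1 \<le> j" "j \<le> n" "l (j - 1) \<le> i" "i < l j"
  shows "block l i = j"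
  unfolding block_def
proof (rule Least_equality)
  fix k assume "i < l k"
  show "j \<le> k"
  proof (rule ccontr)
    assume "\<not> j \<le> k"
    then have "l k \<le> l (j - 1)"
      using assms by (intro increasing_upto[OF inc]) auto
    with assms \<open>i < l k\<close> show False by simp
  qed
qed (rule assms)

lemma block_bounds:
  assumes "l 0 = 0" "i < l n"
  shows "1 \<le> block l i" "block l i \<le> n" "l (block l i - 1) \<le> i" "i < l (block l i)"
proof -
  show lt: "i < l (block l i)"
    unfolding block_def by (rule LeastI) (rule assms)
  show "1 \<le> block l i"
    using lt assms(1) by (cases "block l i") auto
  show "block l i \<le> n"
    unfolding block_def by (rule Least_le) (rule assms)
  show "l (block l i - 1) \<le> i"
    using not_less_Least[of "block l i - 1" "\<lambda>j. i < l j"] \<open>1 \<le> block l i\<close>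
    by (simp add: block_def not_less)
qed

text \<open>Consecutive blocks tile the range below \<open>l m\<close>, so a double sum over blocks
  becomes one sum with coefficients read off from \<open>block\<close>.\<close>

lemma sum_blocks:
  fixes g :: "nat \<Rightarrow> nat \<Rightarrow> real"
  assumes "l 0 = 0" and inc: "\<forall>j<n. l j < l (j + 1)" and "m \<le> n"
  shows "(\<Sum>j=1..m. \<Sum>i=l (j - 1)..<l j. g j i) = (\<Sum>i<l m. g (block l i) i)"
  using \<open>m \<le> n\<close>
proof (induction m)
  case (Suc m)
  have "(\<Sum>i<l (Suc m). g (block l i) i) =
      (\<Sum>i<l m. g (block l i) i) + (\<Sum>i=l m..<l (Suc m). g (block l i) i)"
    using inc Suc.prems sum.atLeastLessThan_concat[of 0 "l m" "l (Suc m)" "\<lambda>i. g (block l i) i"]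
    by (simp add: atLeast0LessThan less_imp_le)
  also have "(\<Sum>i=l m..<l (Suc m). g (block l i) i) = (\<Sum>i=l m..<l (Suc m). g (Suc m) i)"
    by (rule sum.cong) (use block_eq[OF inc, of "Suc m"] Suc.prems in auto)
  finally show ?case using Suc by simp
qed (simp add: assms)

lemma alternating_block_chain:
  assumes "n \<ge> 5" "odd n" "l 0 = 0" and inc: "\<forall>j<n. l j < l (j + 1)" and i: "i < l n"
  obtains p1 p2 p3 p4 p5 where "p1 < p2" "p2 < p3" "p3 < p4" "p4 < p5" "p5 < l n"
    "i \<in> {p1, p2, p3, p4, p5}"
    "odd (block l p1) \<noteq> odd (block l p2)" "odd (block l p2) \<noteq> odd (block l p3)"
    "odd (block l p3) \<noteq> odd (block l p4)" "odd (block l p4) \<noteq> odd (block l p5)"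
proof -
  define j where "j = block l i"
  note j = block_bounds[OF assms(3) i, folded j_def]
  \<comment> \<open>One position per block: \<open>i\<close> in its own block and the left end in
    every other. It remains to choose five block numbers of alternating parity, \<open>j\<close>
    among them.\<close>
  define p where "p k = (if k = j then i else l (k - 1))" for k
  have p_bounds: "l (k - 1) \<le> p k \<and> p k < l k" if "1 \<le> k" "k \<le> n" for k
    using that j strictly_increasing_upto[OF inc, of "k - 1" k] by (auto simp: p_def)
  have p_block: "block l (p k) = k" if "1 \<le> k" "k \<le> n" for k
    using that p_bounds[OF that] by (intro block_eq[OF inc]) auto
  have p_less: "p k < p k'" if "1 \<le> k" "k < k'" "k' \<le> n" for k k'
  proof -
    have "l k \<le> l (k' - 1)"
      using that by (intro increasing_upto[OF inc]) auto
    with p_bounds[of k] p_bounds[of k'] that show ?thesis by auto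
  qed
  have p_bound: "p k < l n" if "1 \<le> k" "k \<le> n" for k
    using p_bounds[OF that] increasing_upto[OF inc that(2) order_refl] by simp
  have "\<exists>j1 j2 j3 j4 j5. 1 \<le> j1 \<and> j1 < j2 \<and> j2 < j3 \<and> j3 < j4 \<and> j4 < j5 \<and> j5 \<le> n \<and>
      j \<in> {j1, j2, j3, j4, j5} \<and>
      odd j1 \<noteq> odd j2 \<and> odd j2 \<noteq> odd j3 \<and> odd j3 \<noteq> odd j4 \<and> odd j4 \<noteq> odd j5"
  proof -
    consider "j \<le> 5" | "j > 5" "odd j" | "j > 5" "even j" by linarith
    then show ?thesis
    proof cases
      case 1
      then have "j \<in> {1, 2, 3, 4, 5}" using j by auto
      then show ?thesis
        using \<open>n \<ge> 5\<close>
        by (intro exI[of _ 1] exI[of _ 2] exI[of _ 3] exI[of _ 4] exI[of _ 5]) auto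
    next
      case 2
      then show ?thesis
        using j by (intro exI[of _ 1] exI[of _ 2] exI[of _ 3] exI[of _ 4] exI[of _ j]) auto
    next
      case 3
      \<comment> \<open>An even \<open>j\<close> above 5 goes in fourth place and needs a successor
        block, which exists because \<open>n\<close> is odd.\<close>
      then have "j < n" using j \<open>odd n\<close> by (cases "j = n") auto
      with 3 show ?thesis
        by (intro exI[of _ 1] exI[of _ 2] exI[of _ 3] exI[of _ j] exI[of _ "Suc j"]) auto
    qed
  qed
  then obtain j1 j2 j3 j4 j5 where js: "1 \<le> j1" "j1 < j2" "j2 < j3" "j3 < j4" "j4 < j5" "j5 \<le> n"
      and mem: "j \<in> {j1, j2, j3, j4, j5}"
      and alt: "odd j1 \<noteq> odd j2" "odd j2 \<noteq> odd j3" "odd j3 \<noteq> odd j4" "odd j4 \<noteq> odd j5"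
    by metis
  have "i \<in> {p j1, p j2, p j3, p j4, p j5}"
    using mem by (auto simp: p_def)
  then show ?thesis
    using js alt by (intro that[of "p j1" "p j2" "p j3" "p j4" "p j5"]) (simp_all add: p_less p_bound p_block)
qed

section \<open>From the block inequality to antipodal weights\<close>

theorem theorem7p4:
  fixes n N :: nat and l :: "nat \<Rightarrow> nat" and \<beta> \<beta>' :: real
    and G :: "('v, 'e::finite) ugraph" and v :: "nat \<Rightarrow> 'v" and edge :: "nat \<Rightarrow> 'e"
  assumes "n \<ge> 5" and "odd n" and "N \<ge> n"
    and "l 0 = 0" and "\<forall>j<n. l j < l (j + 1)" and "l n = N"
    and "\<beta> \<in> {1, 2}" and "\<beta>' = 3 - \<beta>"
    and "is_cycle G (2 * N) v edge"
  shows "defines_shared_facet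
    (\<lambda>x. \<Sum>j=1..n. \<Sum>i=l (j - 1)..<l j.
        (if odd j then \<beta> else \<beta>') * x $ edge i + (if odd j then \<beta>' else \<beta>) * x $ edge (i + N))
    3 G (antipodal_pairs N v)"
proof -
  define u where "u i = (if odd (block l i) then \<beta> else \<beta>')" for i
  have u_compl: "(if odd (block l i) then \<beta>' else \<beta>) = 3 - u i" for i
    using assms(8) by (simp add: u_def)
  \<comment> \<open>\<open>\<beta>\<close> and \<open>\<beta>'\<close> are 1 and 2 in some order, so
    alternating block parities give alternating weights.\<close>
  have u_neq: "u p \<noteq> u q" if "odd (block l p) \<noteq> odd (block l q)" for p q
    using that assms(7,8) by (auto simp: u_def)
  have "(\<Sum>j=1..n. \<Sum>i=l (j - 1)..<l j.
        (if odd j then \<beta> else \<beta>') * x $ edge i + (if odd j then \<beta>' else \<beta>) * x $ edge (i + N)) =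
      (\<Sum>k<2 * N. antipodal_weight N u k * x $ edge k)" for x :: "real ^ 'e"
  proof -
    have "(\<Sum>j=1..n. \<Sum>i=l (j - 1)..<l j.
        (if odd j then \<beta> else \<beta>') * x $ edge i + (if odd j then \<beta>' else \<beta>) * x $ edge (i + N)) =
      (\<Sum>i<N. u i * x $ edge i + (3 - u i) * x $ edge (i + N))"
      using sum_blocks[OF assms(4,5) order_refl] by (simp only: assms(6) u_compl u_def[symmetric])
    also have "\<dots> = (\<Sum>i<N. antipodal_weight N u i * x $ edge i) +
        (\<Sum>i<N. antipodal_weight N u (i + N) * x $ edge (i + N))"
      by (simp add: sum.distrib antipodal_weight_def)
    also have "\<dots> = (\<Sum>k<2 * N. antipodal_weight N u k * x $ edge k)"
      using sum.atLeastLessThan_concat[of 0 N "N + N" "\<lambda>k. antipodal_weight N u k * x $ edge k"]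
        sum.shift_bounds_nat_ivl[of "\<lambda>k. antipodal_weight N u k * x $ edge k" 0 N N]
      by (simp add: atLeast0LessThan mult_2)
    finally show ?thesis .
  qed
  moreover have "defines_shared_facet
      (\<lambda>x. \<Sum>k<2 * N. antipodal_weight N u k * x $ edge k) 3 G (antipodal_pairs N v)"
  proof (rule defines_shared_facet_antipodal_weight[OF assms(9)])
    show "N \<ge> 2" using assms by simp
    show "u i \<in> {1, 2}" for i using assms(7,8) by (auto simp: u_def)
    fix i assume "i < N"
    then have "i < l n" using assms(6) by simp
    from alternating_block_chain[OF assms(1,2,4,5) this]
    show "\<exists>p1 p2 p3 p4 p5.
      p1 < p2 \<and> p2 < p3 \<and> p3 < p4 \<and> p4 < p5 \<and> p5 < N \<and> i \<in> {p1, p2, p3, p4, p5} \<and>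
      u p1 \<noteq> u p2 \<and> u p2 \<noteq> u p3 \<and> u p3 \<noteq> u p4 \<and> u p4 \<noteq> u p5"
      using assms(6) u_neq by metis
  qed
  ultimately show ?thesis by simp
qed

end
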